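(* Let $n\ge 2$ and let $G$ be the banana graph with $n$ internal edges. The copositive cone of $G$ equals $$\mathcal{C}_G=\Big\{(m,s)\in\mathbb{R}^{n+1}\ :\ m_1,\dots,m_n\ge 0\ \text{ and }\ \sum_{i=1}^n m_i+2\sum_{i<j}\sqrt{m_i}\sqrt{m_j}\ \ge\ s\Big\}.$$ It follows that the algebraic boundary of $\mathcal{C}_G$ is the union of the $n$ coordinate hyperplanes $\{m_i=0\}$, $i=1,\dots,n$, with an irreducible hypersurface of degree $2^{n-1}$.
   Context: The banana graph with $n$ internal edges has two vertices joined by $n$ parallel internal edges (with external edges attached at these two vertices); its number of loops is $\ell=n-1$. Its second Symanzik polynomial depends on the parameters $z=(m,s)=(m_1,\dots,m_n,s)\in\mathbb{R}^{n+1}$ and is the following homogeneous polynomial of degree $n$ in $x_1,\dots,x_n$: $$\mathcal{F}_z(x)=x_1x_2\cdots x_n\cdot\Big(\Big(\sum_{i=1}^n m_ix_i\Big)\Big(\sum_{j=1}^n\frac1{x_j}\Big)-s\Big).$$ The copositive cone is $\mathcal{C}_G=\{(m,s)\in\mathbb{R}^{n+1}:\mathcal{F}_z(u)\ge 0\text{ for all }u\in\mathbb{R}^n_{\ge 0}\}$. The algebraic boundary of a semialgebraic set in $\mathbb{R}^{n+1}$ is the Zariski closure (in $\mathbb{C}^{n+1}$) of its topological boundary. *)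

theory Defs
  imports "HOL-Analysis.Analysis" "HOL-Library.Poly_Mapping"
    "HOL-Computational_Algebra.Factorial_Ring"
begin

text \<open>
  The edges of the banana graph are the elements of a finite type \<open>'n\<close>, whose linear order serves
  only to index sums over \<open>i < j\<close>.  A parameter \<open>(m, s)\<close> in R^(n+1) is an element of
  \<open>(real ^ 'n) \<times> real\<close>.

  The factor 1/x_j is cleared against the product of all x_k, so that this is the polynomial on
  all of R^n, including the points with a vanishing coordinate; see \<open>banana_symanzik_eq\<close>.
\<close>

definition banana_symanzik :: "(real ^ 'n) \<times> real \<Rightarrow> real ^ 'n \<Rightarrow> real" where
  "banana_symanzik = (\<lambda>(m, s) x.
     (\<Sum>i\<in>UNIV. m $ i * x $ i) * (\<Sum>j\<in>UNIV. \<Prod>k\<in>UNIV - {j}. x $ k)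
       - s * (\<Prod>k\<in>UNIV. x $ k))"

lemma banana_symanzik_eq:
  fixes m x :: "real ^ 'n"
  assumes "\<And>i. x $ i \<noteq> 0"
  shows "banana_symanzik (m, s) x =
    (\<Prod>k\<in>UNIV. x $ k) * ((\<Sum>i\<in>UNIV. m $ i * x $ i) * (\<Sum>j\<in>UNIV. 1 / x $ j) - s)"
proof -
  have "(\<Prod>k\<in>UNIV - {j}. x $ k) = (\<Prod>k\<in>UNIV. x $ k) * (1 / x $ j)" for j
    using assms[of j] by (simp add: prod_diff1)
  then have "(\<Sum>j\<in>UNIV. \<Prod>k\<in>UNIV - {j}. x $ k) = (\<Prod>k\<in>UNIV. x $ k) * (\<Sum>j\<in>UNIV. 1 / x $ j)"
    by (simp only: sum_distrib_left)
  then show ?thesis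
    by (simp only: banana_symanzik_def case_prod_conv) (simp only: algebra_simps)
qed

definition copositive_cone :: "('z \<Rightarrow> real ^ 'n \<Rightarrow> real) \<Rightarrow> 'z set" where
  "copositive_cone F = {z. \<forall>u. (\<forall>i. 0 \<le> u $ i) \<longrightarrow> 0 \<le> F z u}"

text \<open>Polynomials over C in the variables \<open>'v\<close>, as finitely supported maps from exponents to
  coefficients.\<close>

type_synonym 'v cpoly = "('v \<Rightarrow>\<^sub>0 nat) \<Rightarrow>\<^sub>0 complex"

definition eval_cpoly :: "'v::finite cpoly \<Rightarrow> complex ^ 'v \<Rightarrow> complex" where
  "eval_cpoly p w = (\<Sum>e\<in>Poly_Mapping.keys p.
     Poly_Mapping.lookup p e * (\<Prod>v\<in>UNIV. (w $ v) ^ Poly_Mapping.lookup e v))"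

definition total_degree :: "'v::finite cpoly \<Rightarrow> nat" where
  "total_degree p =
     Max (insert 0 ((\<lambda>e. \<Sum>v\<in>UNIV. Poly_Mapping.lookup e v) ` Poly_Mapping.keys p))"

definition zariski_closed :: "(complex ^ 'v) set \<Rightarrow> bool" where
  "zariski_closed Z \<longleftrightarrow> (\<exists>P :: 'v cpoly set. Z = {w. \<forall>p\<in>P. eval_cpoly p w = 0})"

definition irreducible_hypersurface :: "nat \<Rightarrow> (complex ^ 'v) set \<Rightarrow> bool" where
  "irreducible_hypersurface d H \<longleftrightarrow>
     (\<exists>p :: 'v cpoly. irreducible p \<and> total_degree p = d \<and> H = {w. eval_cpoly p w = 0})"

text \<open>C^(n+1) is \<open>complex ^ 'n option\<close>: coordinate \<open>Some i\<close> is m_i and coordinate \<open>None\<close> is s.\<close>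

definition complexify :: "(real ^ 'n) \<times> real \<Rightarrow> complex ^ 'n option" where
  "complexify = (\<lambda>(m, s).
     \<chi> v. case v of Some i \<Rightarrow> complex_of_real (m $ i) | None \<Rightarrow> complex_of_real s)"

definition algebraic_boundary :: "((real ^ 'n) \<times> real) set \<Rightarrow> (complex ^ 'n option) set" where
  "algebraic_boundary S = zariski_closed hull (complexify ` frontier S)"

end

theory Submission
  imports Defs "HOL-Computational_Algebra.Fundamental_Theorem_Algebra"
begin

text \<open>\<^bold>\<open>The cone.\<close>  For \<open>m \<ge> 0\<close> and \<open>x > 0\<close> the Cauchy-Schwarz inequality gives
  \<open>(\<Sum>i. m i * x i) * (\<Sum>j. 1 / x j) \<ge> (\<Sum>i. sqrt (m i))\<^sup>2\<close>, with equality at \<open>x i = 1 / sqrt (m i)\<close>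
  when all masses are positive, so the threshold for \<open>s\<close> is \<open>(\<Sum>i. sqrt (m i))\<^sup>2\<close>, which is the bound of the theorem multiplied out.
  That copositivity forces \<open>m \<ge> 0\<close> is seen on the faces of the orthant: where one coordinate vanishes,
  the polynomial is the linear form \<open>\<Sum>i. m i * x i\<close> times a nonnegative product.  This is
  \<open>copositive_cone_banana\<close>.

  \<^bold>\<open>The boundary.\<close>  The topological boundary consists of the points of the cone with some \<open>m i = 0\<close>
  and those with \<open>s = (\<Sum>i. sqrt (m i))\<^sup>2\<close> (\<open>frontier_mass_cone\<close>).  The points of the first kind contain
  an open part of each coordinate hyperplane, hence are Zariski dense in it.  Those of the second kind
  are the image of the nonnegative orthant under \<open>t \<mapsto> ((t i)\<^sup>2, (\<Sum>i. t i)\<^sup>2)\<close>, and a polynomial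
  vanishing on the image of the positive orthant vanishes on the image of all of \<open>C^n\<close>.  The latter image
  is the zero set of the norm
    \<open>p (m, s) = \<Prod>\<epsilon>. (s - (\<Sum>i. \<epsilon> i * sqrt (m i))\<^sup>2)\<close>,
  where \<open>\<epsilon>\<close> runs over the sign vectors up to a common sign.  There are \<open>2 ^ (n - 1)\<close> of these.  The
  product is even in every \<open>t i = sqrt (m i)\<close>, hence a polynomial in \<open>m\<close> and \<open>s\<close>
  (\<open>norm_form_polynomial\<close>), and it is homogeneous of degree \<open>2 ^ (n - 1)\<close> because each factor scales
  like \<open>s\<close>.

  \<^bold>\<open>Irreducibility.\<close>  Suppose \<open>p = a * b\<close>.  Pulled back along the parametrization the product is zero,
  so one factor, say \<open>a\<close>, vanishes on the whole hypersurface.  For generic \<open>m\<close> the \<open>2 ^ (n - 1)\<close>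
  roots of \<open>p (m, \<cdot>)\<close> are distinct and all of them are roots of \<open>a (m, \<cdot>)\<close>, so \<open>b (m, \<cdot>)\<close> is constant;
  by density this holds for every \<open>m\<close>.  Then \<open>b\<close> has no zero at all, since a zero would make the monic
  polynomial \<open>p (m, \<cdot>)\<close> vanish identically, and a polynomial without zeros is constant by
  the fundamental theorem of algebra on lines through the origin (\<open>factor_of_norm_form_constant\<close>).

  Polynomials are treated throughout as functions on \<open>C^v\<close>.  What is needed about them reduces to one
  variable by restriction to lines (\<open>polynomial_on_line\<close>), and coefficients are recovered from values
  by \<open>monomials_independent\<close>.\<close>

section \<open>Polynomial functions\<close>

abbreviation monomial_value :: "('v::finite \<Rightarrow>\<^sub>0 nat) \<Rightarrow> complex ^ 'v \<Rightarrow> complex" where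
  "monomial_value e w \<equiv> (\<Prod>v\<in>UNIV. (w $ v) ^ Poly_Mapping.lookup e v)"

lemma eval_cpoly_superset:
  assumes "finite K" "Poly_Mapping.keys p \<subseteq> K"
  shows "eval_cpoly p w = (\<Sum>e\<in>K. Poly_Mapping.lookup p e * monomial_value e w)"
  unfolding eval_cpoly_def using assms
  by (intro sum.mono_neutral_left) (auto simp: in_keys_iff)

lemma eval_cpoly_zero [simp]: "eval_cpoly 0 w = 0"
  by (simp add: eval_cpoly_def)

lemma eval_cpoly_single: "eval_cpoly (Poly_Mapping.single e c) w = c * monomial_value e w"
  by (subst eval_cpoly_superset[of "{e}"]) auto

lemma eval_cpoly_one [simp]: "eval_cpoly 1 w = 1"
  by (simp add: eval_cpoly_single flip: single_one)

lemma eval_cpoly_add: "eval_cpoly (p + q) w = eval_cpoly p w + eval_cpoly q w"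
proof -
  define K where "K = Poly_Mapping.keys p \<union> Poly_Mapping.keys q"
  have "finite K" "Poly_Mapping.keys p \<subseteq> K" "Poly_Mapping.keys q \<subseteq> K" "Poly_Mapping.keys (p + q) \<subseteq> K"
    using keys_add[of p q] by (auto simp: K_def)
  then show ?thesis
    by (simp add: eval_cpoly_superset[of K] lookup_add algebra_simps sum.distrib)
qed

lemma eval_cpoly_sum: "eval_cpoly (\<Sum>i\<in>I. p i) w = (\<Sum>i\<in>I. eval_cpoly (p i) w)"
  by (induction I rule: infinite_finite_induct) (auto simp: eval_cpoly_add)

lemma poly_mapping_sum_singles:
  "p = (\<Sum>e\<in>Poly_Mapping.keys p. Poly_Mapping.single e (Poly_Mapping.lookup p e))"
  by (rule poly_mapping_eqI) (auto simp: lookup_sum lookup_single when_def in_keys_iff)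

lemma eval_cpoly_mult: "eval_cpoly (p * q) w = eval_cpoly p w * eval_cpoly q w"
proof -
  let ?c = "Poly_Mapping.lookup"
  have "p * q = (\<Sum>e\<in>Poly_Mapping.keys p. Poly_Mapping.single e (?c p e)) *
      (\<Sum>d\<in>Poly_Mapping.keys q. Poly_Mapping.single d (?c q d))"
    by (simp flip: poly_mapping_sum_singles)
  also have "\<dots> = (\<Sum>e\<in>Poly_Mapping.keys p. \<Sum>d\<in>Poly_Mapping.keys q.
      Poly_Mapping.single (e + d) (?c p e * ?c q d))"
    by (simp add: sum_product mult_single)
  finally have "eval_cpoly (p * q) w = (\<Sum>e\<in>Poly_Mapping.keys p. \<Sum>d\<in>Poly_Mapping.keys q.
      (?c p e * ?c q d) * monomial_value (e + d) w)"
    by (simp add: eval_cpoly_sum eval_cpoly_single)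
  then show ?thesis
    by (simp add: eval_cpoly_def sum_product lookup_add power_add prod.distrib mult_ac)
qed

definition polynomial_on_C :: "(complex ^ 'v::finite \<Rightarrow> complex) \<Rightarrow> bool" where
  "polynomial_on_C f \<longleftrightarrow> (\<exists>p. \<forall>w. f w = eval_cpoly p w)"

named_theorems polynomial_intros

lemma polynomial_eval_cpoly [polynomial_intros]: "polynomial_on_C (eval_cpoly p)"
  unfolding polynomial_on_C_def by blast

lemma polynomial_const [polynomial_intros]: "polynomial_on_C (\<lambda>w. c)"
  unfolding polynomial_on_C_def
  by (rule exI[of _ "Poly_Mapping.single 0 c"]) (simp add: eval_cpoly_single)

lemma polynomial_coordinate [polynomial_intros]: "polynomial_on_C (\<lambda>w. w $ v)"
proof -
  have "eval_cpoly (Poly_Mapping.single (Poly_Mapping.single v 1) 1) w = w $ v" for w :: "complex ^ 'a"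
  proof -
    have "monomial_value (Poly_Mapping.single v 1) w = (\<Prod>u\<in>UNIV. if u = v then w $ u else 1)"
      by (intro prod.cong) (auto simp: lookup_single when_def)
    then show ?thesis by (simp add: eval_cpoly_single)
  qed
  then show ?thesis unfolding polynomial_on_C_def by metis
qed

lemma polynomial_add [polynomial_intros]:
  "polynomial_on_C f \<Longrightarrow> polynomial_on_C g \<Longrightarrow> polynomial_on_C (\<lambda>w. f w + g w)"
  unfolding polynomial_on_C_def by (metis eval_cpoly_add)

lemma polynomial_mult [polynomial_intros]:
  "polynomial_on_C f \<Longrightarrow> polynomial_on_C g \<Longrightarrow> polynomial_on_C (\<lambda>w. f w * g w)"
  unfolding polynomial_on_C_def by (metis eval_cpoly_mult)

lemma polynomial_minus [polynomial_intros]: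
  "polynomial_on_C f \<Longrightarrow> polynomial_on_C (\<lambda>w. - f w)"
  using polynomial_mult[OF polynomial_const[of "-1"]] by simp

lemma polynomial_diff [polynomial_intros]:
  "polynomial_on_C f \<Longrightarrow> polynomial_on_C g \<Longrightarrow> polynomial_on_C (\<lambda>w. f w - g w)"
  using polynomial_add[OF _ polynomial_minus[of g]] by simp

lemma polynomial_power [polynomial_intros]:
  "polynomial_on_C f \<Longrightarrow> polynomial_on_C (\<lambda>w. f w ^ k)"
  by (induction k) (auto intro: polynomial_intros)

lemma polynomial_sum [polynomial_intros]:
  "(\<And>i. i \<in> I \<Longrightarrow> polynomial_on_C (f i)) \<Longrightarrow> polynomial_on_C (\<lambda>w. \<Sum>i\<in>I. f i w)"
  by (induction I rule: infinite_finite_induct) (auto intro: polynomial_intros)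

lemma polynomial_prod [polynomial_intros]:
  "(\<And>i. i \<in> I \<Longrightarrow> polynomial_on_C (f i)) \<Longrightarrow> polynomial_on_C (\<lambda>w. \<Prod>i\<in>I. f i w)"
  by (induction I rule: infinite_finite_induct) (auto intro: polynomial_intros)

lemma polynomial_compose:
  assumes "polynomial_on_C f" "\<And>v. polynomial_on_C (\<lambda>w. g w $ v)"
  shows "polynomial_on_C (\<lambda>w. f (g w))"
proof -
  obtain p where p: "\<And>w. f w = eval_cpoly p w"
    using assms(1) by (auto simp: polynomial_on_C_def)
  show ?thesis
    unfolding p eval_cpoly_def by (intro polynomial_intros assms(2))
qed

text \<open>Questions about zeros of polynomials in several variables are settled on suitable lines, where a nonzero polynomial has finitely many roots.\<close>

lemma polynomial_on_line:
  assumes "polynomial_on_C f"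
  obtains q :: "complex poly" where "\<And>l. f (u + l *s v) = poly q l"
proof -
  obtain p where p: "\<And>w. f w = eval_cpoly p w"
    using assms(1) by (auto simp: polynomial_on_C_def)
  show ?thesis
    by (rule that[of "\<Sum>e\<in>Poly_Mapping.keys p. smult (Poly_Mapping.lookup p e)
           (\<Prod>i\<in>UNIV. [:u $ i, v $ i:] ^ Poly_Mapping.lookup e i)"])
       (simp add: p eval_cpoly_def poly_sum poly_prod)
qed

text \<open>The complement of a hypersurface is dense: on the line through \<open>u\<close> and \<open>v\<close> neither polynomial
  vanishes identically, so all but finitely many points of that line are nonzeros of both.\<close>

lemma common_nonzero:
  assumes "polynomial_on_C f" "polynomial_on_C g" "f u \<noteq> 0" "g v \<noteq> 0"
  obtains w where "f w \<noteq> 0" "g w \<noteq> 0"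
proof -
  obtain F where F: "\<And>l. f (u + l *s (v - u)) = poly F l"
    using polynomial_on_line[OF assms(1)] by blast
  obtain G where G: "\<And>l. g (u + l *s (v - u)) = poly G l"
    using polynomial_on_line[OF assms(2)] by blast
  have "poly F 0 \<noteq> 0" "poly G 1 \<noteq> 0"
    using F[of 0] G[of 1] assms(3,4) by simp_all
  then have "F * G \<noteq> 0" by auto
  then have "finite {l. poly (F * G) l = 0}" by (rule poly_roots_finite)
  then have "\<exists>l. l \<notin> {l. poly (F * G) l = 0}"
    by (rule ex_new_if_finite[OF infinite_UNIV_char_0])
  then obtain l where "poly F l \<noteq> 0" "poly G l \<noteq> 0" by auto
  then show ?thesis using that F G by metis
qed

lemma polynomial_product_zero:
  assumes "polynomial_on_C f" "polynomial_on_C g" "\<And>w. f w * g w = 0"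
  shows "(\<forall>w. f w = 0) \<or> (\<forall>w. g w = 0)"
proof (rule ccontr)
  assume "\<not> ?thesis"
  then obtain u v where "f u \<noteq> 0" "g v \<noteq> 0" by blast
  then obtain w where "f w \<noteq> 0" "g w \<noteq> 0"
    using common_nonzero[OF assms(1,2)] by blast
  then show False using assms(3)[of w] by simp
qed

lemma common_nonzero_family:
  assumes "finite I" "\<And>i. i \<in> I \<Longrightarrow> polynomial_on_C (f i)" "\<And>i. i \<in> I \<Longrightarrow> \<exists>w. f i w \<noteq> 0"
  shows "\<exists>w. \<forall>i\<in>I. f i w \<noteq> 0"
  using assms
proof (induction I rule: finite_induct)
    case (insert a I)
    have "\<exists>w. \<forall>i\<in>I. f i w \<noteq> 0"
      by (rule insert.IH) (simp_all add: insert.prems)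
    then obtain u where u: "\<forall>i\<in>I. f i u \<noteq> 0" ..
    obtain v where v: "f a v \<noteq> 0" using insert.prems(2)[of a] by auto
    have "polynomial_on_C (\<lambda>w. \<Prod>i\<in>I. f i w)"
      by (intro polynomial_prod insert.prems(1)) simp
    moreover have "polynomial_on_C (f a)" by (simp add: insert.prems(1))
    moreover have "(\<Prod>i\<in>I. f i u) \<noteq> 0" using u insert.hyps(1) by simp
    ultimately obtain w where "(\<Prod>i\<in>I. f i w) \<noteq> 0" "f a w \<noteq> 0"
      using v by (rule common_nonzero)
    then show ?case using insert.hyps(1) by (intro exI[of _ w]) simp
qed auto

text \<open>The hypothesis is extended to all of the space by freeing one coordinate at a time: in the direction
  of that coordinate there are infinitely many zeros already.\<close>

lemma polynomial_zero_of_grid: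
  assumes "polynomial_on_C f" "\<And>v. infinite (S v)"
    and zero: "\<And>w. (\<And>v. w $ v \<in> S v) \<Longrightarrow> f w = 0"
  shows "f w = 0"
proof -
  have "\<forall>w. (\<forall>v. v \<notin> A \<longrightarrow> w $ v \<in> S v) \<longrightarrow> f w = 0" if "finite A" for A
    using that
  proof (induction A rule: finite_induct)
    case empty
    then show ?case using zero by auto
  next
    case (insert a A)
    show ?case
    proof (intro allI impI)
      fix w :: "complex ^ 'a" assume w: "\<forall>v. v \<notin> insert a A \<longrightarrow> w $ v \<in> S v"
      define u where "u = (\<chi> v. if v = a then 0 else w $ v)"
      obtain q where q: "\<And>l. f (u + l *s axis a 1) = poly q l"
        using polynomial_on_line[OF assms(1)] by blast
      have "poly q l = 0" if "l \<in> S a" for l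
      proof -
        have "\<forall>v. v \<notin> A \<longrightarrow> (u + l *s axis a 1) $ v \<in> S v"
          using w that by (auto simp: u_def axis_def)
        then show ?thesis using insert.IH q by metis
      qed
      then have "S a \<subseteq> {l. poly q l = 0}" by auto
      then have "q = 0"
        using assms(2)[of a] poly_roots_finite[of q] finite_subset by blast
      moreover have "w = u + (w $ a) *s axis a 1"
        by (auto simp: vec_eq_iff u_def axis_def)
      ultimately show "f w = 0" using q[of "w $ a"] by simp
    qed
  qed
  from this[of UNIV] show ?thesis by simp
qed

text \<open>Monomials are multiplicative characters.  At a point \<open>w\<close> where the finitely many monomials take
  distinct values \<open>x e\<close>, the powers \<open>w ^ k\<close> (taken coordinatewise) give \<open>(\<Sum>e\<in>E. c e * x e ^ k) = 0\<close>
  for all \<open>k\<close>, and a Lagrange interpolation polynomial isolates a single coefficient.\<close>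

lemma monomials_independent:
  assumes "finite E" "e0 \<in> E"
    and zero: "\<And>w. (\<Sum>e\<in>E. c e * monomial_value e w) = 0"
  shows "c e0 = 0"
proof -
  have sep: "\<exists>w. monomial_value e w - monomial_value e' w \<noteq> 0" if ne: "e \<noteq> e'" for e e' :: "'a \<Rightarrow>\<^sub>0 nat"
  proof -
    have "\<exists>v. Poly_Mapping.lookup e v \<noteq> Poly_Mapping.lookup e' v"
      using ne by (auto simp: poly_mapping_eq_iff fun_eq_iff)
    then obtain v where v: "Poly_Mapping.lookup e v \<noteq> Poly_Mapping.lookup e' v" ..
    \<comment> \<open>The powers of 2 are distinct, so this point tells exponents of \<open>v\<close> apart.\<close>
    define w :: "complex ^ 'a" where "w = (\<chi> u. if u = v then 2 else 1)"
    have "monomial_value d w = (\<Prod>u\<in>UNIV. if u = v then 2 ^ Poly_Mapping.lookup d u else 1)"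
      for d :: "'a \<Rightarrow>\<^sub>0 nat"
      by (intro prod.cong) (auto simp: w_def)
    then have "monomial_value d w = of_nat (2 ^ Poly_Mapping.lookup d v)" for d :: "'a \<Rightarrow>\<^sub>0 nat"
      by simp
    then have "monomial_value e w \<noteq> monomial_value e' w"
      using v by (simp only: of_nat_eq_iff) simp
    then show ?thesis by auto
  qed
  define I where "I = {(e, e'). e \<in> E \<and> e' \<in> E \<and> e \<noteq> e'}"
  have "\<exists>w. \<forall>i\<in>I. monomial_value (fst i) w - monomial_value (snd i) w \<noteq> 0"
  proof (rule common_nonzero_family)
    show "finite I"
      by (rule finite_subset[of _ "E \<times> E"]) (use assms(1) in \<open>auto simp: I_def\<close>)
    show "polynomial_on_C (\<lambda>w. monomial_value (fst i) w - monomial_value (snd i) w)"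
      for i :: "('a \<Rightarrow>\<^sub>0 nat) \<times> ('a \<Rightarrow>\<^sub>0 nat)"
      by (intro polynomial_intros)
    show "\<exists>w. monomial_value (fst i) w - monomial_value (snd i) w \<noteq> 0" if "i \<in> I" for i
      using that by (intro sep) (auto simp: I_def)
  qed
  then obtain w where w: "\<forall>i\<in>I. monomial_value (fst i) w - monomial_value (snd i) w \<noteq> 0" ..
  define x where "x e = monomial_value e w" for e
  have x: "x e \<noteq> x e'" if "e \<in> E" "e' \<in> E" "e \<noteq> e'" for e e'
    using bspec[OF w, of "(e, e')"] that by (auto simp: x_def I_def)
  have pow: "(\<Sum>e\<in>E. c e * x e ^ k) = 0" for k
  proof -
    have "monomial_value e (\<chi> v. (w $ v) ^ k) = x e ^ k" for e
      unfolding x_def prod_power_distrib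
      by (intro prod.cong) (simp_all add: mult.commute flip: power_mult)
    then show ?thesis using zero[of "\<chi> v. (w $ v) ^ k"] by simp
  qed
  have q: "(\<Sum>e\<in>E. c e * poly q (x e)) = 0" for q
  proof -
    have "(\<Sum>e\<in>E. c e * poly q (x e)) = (\<Sum>k\<le>degree q. coeff q k * (\<Sum>e\<in>E. c e * x e ^ k))"
      unfolding poly_altdef sum_distrib_left by (subst sum.swap) (simp add: mult_ac)
    then show ?thesis by (simp add: pow)
  qed
  define L where "L = (\<Prod>e\<in>E - {e0}. [:- x e, 1:])"
  have "poly L (x e) = 0" if "e \<in> E - {e0}" for e
    using that assms(1) by (auto simp: L_def poly_prod intro!: prod_zero bexI[of _ e])
  then have "(\<Sum>e\<in>E. c e * poly L (x e)) = c e0 * poly L (x e0)"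
    using assms(1,2) by (subst sum.remove[of _ e0]) auto
  moreover have "poly L (x e0) \<noteq> 0"
    using assms(1,2) x by (auto simp: L_def poly_prod)
  ultimately show ?thesis using q[of L] by simp
qed

lemma cpoly_eqI:
  assumes "\<And>w. eval_cpoly p w = eval_cpoly q w"
  shows "p = q"
proof -
  have z: "eval_cpoly (p - q) w = 0" for w
    using assms[of w] eval_cpoly_add[of "p - q" q w] by simp
  have "Poly_Mapping.lookup (p - q) e = 0" for e
  proof (cases "e \<in> Poly_Mapping.keys (p - q)")
    case True
    then show ?thesis
      using monomials_independent[of "Poly_Mapping.keys (p - q)" e "Poly_Mapping.lookup (p - q)"]
        z by (simp add: eval_cpoly_def)
  qed (simp add: in_keys_iff)
  then have "p - q = 0" by (intro poly_mapping_eqI) simp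
  then show ?thesis by simp
qed

text \<open>Distinct powers of 4 differ, so a single scaling already detects the degree of each monomial.  The
  factor 4 suits the norm form below: scaling \<open>(m, s)\<close> by 4 amounts to scaling the square roots
  of the \<open>m i\<close> by 2.\<close>

lemma total_degree_homogeneous:
  assumes "p \<noteq> 0" and hom: "\<And>w. eval_cpoly p (4 *s w) = 4 ^ N * eval_cpoly p w"
  shows "total_degree p = N"
proof -
  let ?d = "\<lambda>e. \<Sum>v\<in>UNIV. Poly_Mapping.lookup e v"
  have deg: "?d e = N" if e: "e \<in> Poly_Mapping.keys p" for e
  proof -
    have "(\<Sum>e\<in>Poly_Mapping.keys p. (Poly_Mapping.lookup p e * (4 ^ ?d e - 4 ^ N)) * monomial_value e w) = 0" for w
      using hom[of w]
      by (simp add: eval_cpoly_def power_mult_distrib prod.distrib power_sum sum_distrib_left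
          algebra_simps sum_subtractf)
    then have "Poly_Mapping.lookup p e * (4 ^ ?d e - 4 ^ N) = 0"
      using monomials_independent[of "Poly_Mapping.keys p" e
          "\<lambda>e. Poly_Mapping.lookup p e * (4 ^ ?d e - 4 ^ N)"] e by auto
    then have "of_nat (4 ^ ?d e) = (of_nat (4 ^ N) :: complex)"
      using e by (auto simp: in_keys_iff)
    then show ?thesis by (simp only: of_nat_eq_iff) simp
  qed
  have "Poly_Mapping.keys p \<noteq> {}" 
    using assms(1) by (auto simp: poly_mapping_eq_iff fun_eq_iff in_keys_iff set_eq_iff)
  then obtain e where "e \<in> Poly_Mapping.keys p" by blast
  then have "?d ` Poly_Mapping.keys p = {N}" using deg by (force simp: image_iff)
  then show ?thesis by (simp add: total_degree_def)
qed

text \<open>Evenness in \<open>v\<close> kills, by independence of monomials, every coefficient whose exponent of \<open>v\<close> is odd;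
  the remaining exponents can be halved.\<close>

lemma even_polynomial_in_squares:
  assumes "polynomial_on_C f"
    and even: "\<And>v w. v \<in> A \<Longrightarrow> f (\<chi> u. if u = v then - w $ u else w $ u) = f w"
  shows "\<exists>p. \<forall>w. f w = eval_cpoly p (\<chi> v. if v \<in> A then (w $ v)\<^sup>2 else w $ v)"
proof -
  obtain q where q: "\<And>w. f w = eval_cpoly q w"
    using assms(1) by (auto simp: polynomial_on_C_def)
  have ev: "even (Poly_Mapping.lookup e v)" if "e \<in> Poly_Mapping.keys q" "v \<in> A" for e v
  proof -
    have flip: "monomial_value d (\<chi> u. if u = v then - w $ u else w $ u) =
        (-1) ^ Poly_Mapping.lookup d v * monomial_value d w" for d w
    proof -
      have "monomial_value d (\<chi> u. if u = v then - w $ u else w $ u) =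
          (\<Prod>u\<in>UNIV. (if u = v then (-1) ^ Poly_Mapping.lookup d v else 1) * (w $ u) ^ Poly_Mapping.lookup d u)"
        by (intro prod.cong) (auto simp: power_minus[of "w $ v"])
      then show ?thesis by (simp add: prod.distrib)
    qed
    have "(\<Sum>d\<in>Poly_Mapping.keys q. (Poly_Mapping.lookup q d * (1 - (-1) ^ Poly_Mapping.lookup d v)) *
        monomial_value d w) = 0" for w
    proof -
      have "f w - f (\<chi> u. if u = v then - w $ u else w $ u) = 0"
        using even[OF that(2)] by simp
      then show ?thesis
        unfolding q eval_cpoly_def flip by (simp add: algebra_simps flip: sum_subtractf)
    qed
    then have "Poly_Mapping.lookup q e * (1 - (-1) ^ Poly_Mapping.lookup e v) = 0"
      using monomials_independent[of "Poly_Mapping.keys q" e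
          "\<lambda>d. Poly_Mapping.lookup q d * (1 - (-1) ^ Poly_Mapping.lookup d v)"] that(1) by auto
    then show ?thesis
      using that(1) by (cases "even (Poly_Mapping.lookup e v)") (auto simp: in_keys_iff)
  qed
  define half where "half e = Abs_poly_mapping
      (\<lambda>v. if v \<in> A then Poly_Mapping.lookup e v div 2 else Poly_Mapping.lookup e v)"
    for e :: "'a \<Rightarrow>\<^sub>0 nat"
  have half: "Poly_Mapping.lookup (half e) v =
      (if v \<in> A then Poly_Mapping.lookup e v div 2 else Poly_Mapping.lookup e v)" for e v
    by (simp add: half_def)
  define p where "p = (\<Sum>e\<in>Poly_Mapping.keys q. Poly_Mapping.single (half e) (Poly_Mapping.lookup q e))"
  have "f w = eval_cpoly p (\<chi> v. if v \<in> A then (w $ v)\<^sup>2 else w $ v)" for w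
  proof -
    have "monomial_value (half e) (\<chi> v. if v \<in> A then (w $ v)\<^sup>2 else w $ v) = monomial_value e w"
      if "e \<in> Poly_Mapping.keys q" for e
      using ev[OF that] by (intro prod.cong) (auto simp: half simp flip: power_mult)
    then show ?thesis
      unfolding q p_def eval_cpoly_sum eval_cpoly_single eval_cpoly_def[of q] by simp
  qed
  then show ?thesis by blast
qed

section \<open>The norm form\<close>

definition point :: "complex ^ 'n \<Rightarrow> complex \<Rightarrow> complex ^ 'n option" where
  "point m s = (\<chi> v. case v of Some i \<Rightarrow> m $ i | None \<Rightarrow> s)"

lemma point_nth [simp]: "point m s $ Some i = m $ i" "point m s $ None = s"
  by (simp_all add: point_def)

lemma point_coordinates: "w = point (\<chi> i. w $ Some i) (w $ None)"
  by (simp add: vec_eq_iff point_def split: option.split)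

lemma scale_point: "c *s point m s = point (c *s m) (c * s)"
  by (simp add: vec_eq_iff point_def split: option.split)

definition squares :: "complex ^ 'n \<Rightarrow> complex ^ 'n" where
  "squares t = (\<chi> i. (t $ i)\<^sup>2)"

lemma squares_nth [simp]: "squares t $ i = (t $ i)\<^sup>2"
  by (simp add: squares_def)

lemma squares_surj: obtains t where "m = squares t"
  by (rule that[of "\<chi> i. csqrt (m $ i)"]) (simp add: vec_eq_iff)

lemma point_squares_cases: obtains t s where "w = point (squares t) s"
  by (metis point_coordinates squares_surj)

definition signed :: "'n set \<Rightarrow> complex ^ 'n \<Rightarrow> complex ^ 'n" where
  "signed T t = (\<chi> i. if i \<in> T then - t $ i else t $ i)"

lemma signed_nth: "signed T t $ i = (if i \<in> T then - t $ i else t $ i)"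
  by (simp add: signed_def)

lemma squares_signed [simp]: "squares (signed T t) = squares t"
  by (simp add: vec_eq_iff signed_def)

definition signed_sum :: "'n::finite set \<Rightarrow> complex ^ 'n \<Rightarrow> complex" where
  "signed_sum T t = (\<Sum>i\<in>UNIV. signed T t $ i)"

lemma signed_sum_scale: "signed_sum T (c *s t) = c * signed_sum T t"
  by (auto simp: signed_sum_def signed_nth sum_distrib_left intro!: sum.cong)

text \<open>The factor of a sign set \<open>T\<close> equals that of its complement.  Excluding \<open>i0\<close> picks one of the two, so
  this is the product of the conjugates of \<open>s - (\<Sum>i. t i)\<^sup>2\<close> under sign changes of the \<open>t i\<close>, each
  taken once.\<close>

definition norm_form :: "'n::finite \<Rightarrow> complex ^ 'n \<Rightarrow> complex \<Rightarrow> complex" where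
  "norm_form i0 t s = (\<Prod>T\<in>Pow (- {i0}). s - (signed_sum T t)\<^sup>2)"

lemma card_sign_choices: "card (Pow (- {i0::'n::finite})) = 2 ^ (CARD('n) - 1)"
  by (simp add: card_Pow Compl_eq_Diff_UNIV card_Diff_singleton)

text \<open>Changing the sign of one coordinate permutes the factors; if that coordinate is \<open>i0\<close>, passing to the
  complement restores the normalization.\<close>

lemma norm_form_even: "norm_form i0 (signed {k} t) s = norm_form i0 t s"
proof (cases "k = i0")
  case True
  have "signed_sum T (signed {k} t) = - signed_sum (- {i0} - T) t" if "T \<subseteq> - {i0}" for T
    unfolding signed_sum_def sum_negf[symmetric]
    using that True by (intro sum.cong) (auto simp: signed_nth)
  then show ?thesis
    unfolding norm_form_def
    by (intro prod.reindex_bij_witness[of _ "\<lambda>T. - {i0} - T" "\<lambda>T. - {i0} - T"]) auto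
next
  case False
  let ?flip = "\<lambda>T. if k \<in> T then T - {k} else insert k T"
  have "signed_sum T (signed {k} t) = signed_sum (?flip T) t" for T
    unfolding signed_sum_def by (intro sum.cong) (auto simp: signed_nth)
  then show ?thesis
    unfolding norm_form_def using False
    by (intro prod.reindex_bij_witness[of _ ?flip ?flip]) auto
qed

lemma polynomial_signed_sum [polynomial_intros]:
  assumes "\<And>i. polynomial_on_C (\<lambda>w. g w $ i)"
  shows "polynomial_on_C (\<lambda>w. signed_sum T (g w))"
proof -
  have "polynomial_on_C (\<lambda>w. signed T (g w) $ i)" for i
    by (cases "i \<in> T") (auto simp: signed_nth intro!: polynomial_intros assms)
  then show ?thesis unfolding signed_sum_def by (intro polynomial_intros)
qed

lemma norm_form_polynomial:
  fixes i0 :: "'n::finite"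
  obtains p :: "'n option cpoly" where "\<And>t s. eval_cpoly p (point (squares t) s) = norm_form i0 t s"
proof -
  let ?f = "\<lambda>w. norm_form i0 (\<chi> i. w $ Some i) (w $ None)"
  have "polynomial_on_C ?f"
    unfolding norm_form_def by (intro polynomial_intros) (simp add: polynomial_intros)
  moreover have "?f (\<chi> u. if u = v then - w $ u else w $ u) = ?f w" if "v \<in> range Some" for v w
  proof -
    obtain k where "v = Some k" using \<open>v \<in> range Some\<close> by auto
    then have "(\<chi> i. (\<chi> u. if u = v then - w $ u else w $ u) $ Some i) = signed {k} (\<chi> i. w $ Some i)"
      by (simp add: vec_eq_iff signed_nth)
    then show ?thesis using norm_form_even[of i0 k] \<open>v = Some k\<close> by simp
  qed
  ultimately have "\<exists>p. \<forall>w. ?f w = eval_cpoly p (\<chi> v. if v \<in> range Some then (w $ v)\<^sup>2 else w $ v)"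
    by (rule even_polynomial_in_squares)
  then obtain p where
    p: "\<And>w. ?f w = eval_cpoly p (\<chi> v. if v \<in> range Some then (w $ v)\<^sup>2 else w $ v)"
    by blast
  have "eval_cpoly p (point (squares t) s) = norm_form i0 t s" for t s
  proof -
    have "(\<chi> v. if v \<in> range Some then (point t s $ v)\<^sup>2 else point t s $ v) = point (squares t) s"
      by (auto simp: vec_eq_iff point_def split: option.split)
    then show ?thesis using p[of "point t s"] by simp
  qed
  then show ?thesis by (rule that)
qed

text \<open>With a common sign free to choose, the zero set is the image of the polynomial parametrization
  \<open>u \<mapsto> (squares u, (\<Sum>i. u i)\<^sup>2)\<close>.\<close>

lemma norm_form_zero_iff:
  "norm_form i0 t s = 0 \<longleftrightarrow> (\<exists>u. squares u = squares t \<and> s = (\<Sum>i\<in>UNIV. u $ i)\<^sup>2)"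
proof
  assume "norm_form i0 t s = 0"
  then obtain T where "s = (signed_sum T t)\<^sup>2" by (auto simp: norm_form_def)
  then show "\<exists>u. squares u = squares t \<and> s = (\<Sum>i\<in>UNIV. u $ i)\<^sup>2"
    by (intro exI[of _ "signed T t"]) (simp add: signed_sum_def)
next
  assume "\<exists>u. squares u = squares t \<and> s = (\<Sum>i\<in>UNIV. u $ i)\<^sup>2"
  then obtain u where u: "squares u = squares t" "s = (\<Sum>i\<in>UNIV. u $ i)\<^sup>2" by blast
  define T where "T = {i. u $ i \<noteq> t $ i}"
  have "u $ i = signed T t $ i" for i
    using u(1) by (auto simp: vec_eq_iff T_def signed_nth power2_eq_iff)
  then have sT: "(signed_sum T t)\<^sup>2 = s" using u(2) by (simp add: signed_sum_def)
  define T' where "T' = (if i0 \<in> T then - T else T)"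
  have "signed_sum (- T) t = - signed_sum T t"
    unfolding signed_sum_def sum_negf[symmetric] by (intro sum.cong) (auto simp: signed_nth)
  then have "(signed_sum T' t)\<^sup>2 = s" using sT by (simp add: T'_def)
  moreover have "T' \<in> Pow (- {i0})" by (auto simp: T'_def)
  ultimately show "norm_form i0 t s = 0"
    unfolding norm_form_def by (auto intro!: prod_zero)
qed

text \<open>The two squares are distinct polynomials in \<open>t\<close>: with \<open>t\<close> supported on \<open>i0\<close> and an index \<open>k\<close> where
  the sign sets differ, they take the values 0 and 4.\<close>

lemma signed_sums_separate:
  fixes i0 :: "'n::finite"
  assumes "T \<in> Pow (- {i0})" "T' \<in> Pow (- {i0})" "T \<noteq> T'"
  shows "\<exists>t. (signed_sum T t)\<^sup>2 \<noteq> (signed_sum T' t)\<^sup>2"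
proof -
  obtain k where k: "(k \<in> T) \<noteq> (k \<in> T')" using assms(3) by blast
  then have "k \<noteq> i0" using assms by auto
  define t :: "complex ^ 'n" where "t = (\<chi> i. if i = i0 \<or> i = k then 1 else 0)"
  have "signed_sum S t = (if k \<in> S then 0 else 2)" if "S \<subseteq> - {i0}" for S
  proof -
    have "signed_sum S t = (\<Sum>i\<in>{i0, k}. signed S t $ i)"
      unfolding signed_sum_def by (rule sum.mono_neutral_right) (auto simp: signed_nth t_def)
    then show ?thesis using that \<open>k \<noteq> i0\<close> by (auto simp: signed_nth t_def)
  qed
  then show ?thesis using k assms by (intro exI[of _ t]) auto
qed

section \<open>Irreducibility and degree\<close>

text \<open>The core of irreducibility: if one factor vanishes on the parametrized hypersurface, it takes up all
  the roots in \<open>s\<close> and nothing but a constant is left for the other factor.\<close>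

lemma factor_of_norm_form_constant:
  fixes a b :: "'n::finite option cpoly"
  assumes prod: "\<And>t s. eval_cpoly a (point (squares t) s) * eval_cpoly b (point (squares t) s) = norm_form i0 t s"
    and zero: "\<And>t. eval_cpoly a (point (squares t) ((\<Sum>i\<in>UNIV. t $ i)\<^sup>2)) = 0"
  shows "b dvd 1"
proof -
  let ?S = "Pow (- {i0})"
  have line: "\<exists>q. \<forall>s. eval_cpoly c (point m s) = poly q s" for c m
  proof -
    obtain q where q: "\<And>l. eval_cpoly c (point m 0 + l *s axis None 1) = poly q l"
      using polynomial_on_line[OF polynomial_eval_cpoly] by blast
    have "point m 0 + l *s axis None 1 = point m l" for l
      by (auto simp: vec_eq_iff point_def axis_def split: option.split)
    then show ?thesis using q by auto
  qed
  \<comment> \<open>Where the roots in \<open>s\<close> are distinct, \<open>a\<close> has all of them, so \<open>b\<close> has degree 0 in \<open>s\<close>.\<close>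
  have indep: "eval_cpoly b (point (squares t) s) = eval_cpoly b (point (squares t) 0)"
    if dist: "\<And>T T'. T \<in> ?S \<Longrightarrow> T' \<in> ?S \<Longrightarrow> T \<noteq> T' \<Longrightarrow> (signed_sum T t)\<^sup>2 \<noteq> (signed_sum T' t)\<^sup>2"
    for t s
  proof -
    obtain A B where A: "\<And>s. eval_cpoly a (point (squares t) s) = poly A s"
      and B: "\<And>s. eval_cpoly b (point (squares t) s) = poly B s"
      using line by metis
    define L where "L = (\<Prod>T\<in>?S. [:- (signed_sum T t)\<^sup>2, 1:])"
    have "poly (A * B) s = poly L s" for s
      using prod[of t s] A B by (simp add: L_def norm_form_def poly_prod)
    then have AB: "A * B = L" by (simp add: fun_eq_iff flip: poly_eq_poly_eq_iff)
    have "L \<noteq> 0" by (simp add: L_def)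
    then have nz: "A \<noteq> 0" "B \<noteq> 0" using AB by auto
    have "degree L = card ?S"
      unfolding L_def by (subst degree_prod_eq_sum_degree) auto
    then have deg: "degree A + degree B = card ?S"
      using AB nz degree_mult_eq by metis
    have "poly A ((signed_sum T t)\<^sup>2) = 0" for T
      using zero[of "signed T t"] A by (simp add: signed_sum_def)
    then have "(\<lambda>T. (signed_sum T t)\<^sup>2) ` ?S \<subseteq> {x. poly A x = 0}" by auto
    moreover have "inj_on (\<lambda>T. (signed_sum T t)\<^sup>2) ?S" using dist by (auto simp: inj_on_def)
    ultimately have "card ?S \<le> card {x. poly A x = 0}"
      by (metis card_image card_mono nz(1) poly_roots_finite)
    also have "\<dots> \<le> degree A" using nz(1) by (rule card_poly_roots_bound)
    finally have "degree B = 0" using deg by simp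
    then obtain c where "B = [:c:]" by (rule degree_eq_zeroE)
    then show ?thesis using B by simp
  qed
  \<comment> \<open>The excluded \<open>t\<close> lie on finitely many hypersurfaces, so the identity extends to all \<open>t\<close>.\<close>
  have indep_all: "eval_cpoly b (point (squares t) s) = eval_cpoly b (point (squares t) 0)" for t s
  proof (rule ccontr)
    assume neq: "\<not> ?thesis"
    let ?t = "\<lambda>w. \<chi> i. w $ Some i"
    define g where "g w = eval_cpoly b (point (squares (?t w)) (w $ None)) -
        eval_cpoly b (point (squares (?t w)) 0)" for w
    define I where "I = {(T, T'). T \<in> ?S \<and> T' \<in> ?S \<and> T \<noteq> T'}"
    define D where "D i w = (signed_sum (fst i) (?t w))\<^sup>2 - (signed_sum (snd i) (?t w))\<^sup>2"
      for i :: "'n set \<times> 'n set" and w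
    have coord: "polynomial_on_C (\<lambda>w. point (squares (?t w)) (c w) $ v)" if "polynomial_on_C c" for c v
      using that by (cases v) (auto intro!: polynomial_intros)
    have g: "polynomial_on_C g"
      unfolding g_def
      by (intro polynomial_diff polynomial_compose[OF polynomial_eval_cpoly] coord polynomial_intros)
    have D: "polynomial_on_C (D i)" for i
      unfolding D_def by (intro polynomial_intros) (simp_all add: polynomial_intros)
    have "\<exists>w. D i w \<noteq> 0" if "i \<in> I" for i
    proof -
      have "\<exists>t. (signed_sum (fst i) t)\<^sup>2 \<noteq> (signed_sum (snd i) t)\<^sup>2"
        by (rule signed_sums_separate[of _ i0]) (use that in \<open>auto simp: I_def\<close>)
      then obtain t where "(signed_sum (fst i) t)\<^sup>2 \<noteq> (signed_sum (snd i) t)\<^sup>2" ..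
      then show ?thesis by (intro exI[of _ "point t 0"]) (simp add: D_def)
    qed
    moreover have "finite I" by (rule finite_subset[of _ "UNIV"]) auto
    ultimately have "\<exists>u. \<forall>i\<in>I. D i u \<noteq> 0"
      by (intro common_nonzero_family D)
    then obtain u where "\<forall>i\<in>I. D i u \<noteq> 0" ..
    then have "(\<Prod>i\<in>I. D i u) \<noteq> 0" using \<open>finite I\<close> by simp
    moreover have "g (point t s) \<noteq> 0" using neq by (simp add: g_def)
    moreover have "polynomial_on_C (\<lambda>w. \<Prod>i\<in>I. D i w)" by (intro polynomial_intros D)
    ultimately obtain w where "g w \<noteq> 0" and w: "(\<Prod>i\<in>I. D i w) \<noteq> 0"
      using common_nonzero[of g "\<lambda>w. \<Prod>i\<in>I. D i w"] g by metis
    have "D (T, T') w \<noteq> 0" if "T \<in> ?S" "T' \<in> ?S" "T \<noteq> T'" for T T'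
      using w \<open>finite I\<close> that by (auto simp: I_def)
    then have "g w = 0" unfolding g_def by (subst indep) (auto simp: D_def)
    with \<open>g w \<noteq> 0\<close> show False by simp
  qed
  \<comment> \<open>A zero of \<open>b\<close> would be a zero for every \<open>s\<close>, but the norm form is monic in \<open>s\<close>.\<close>
  have nonzero: "eval_cpoly b w \<noteq> 0" for w
  proof
    assume "eval_cpoly b w = 0"
    obtain t s0 where "w = point (squares t) s0" by (rule point_squares_cases)
    then have "eval_cpoly b (point (squares t) s) = 0" for s
      using \<open>eval_cpoly b w = 0\<close> indep_all by metis
    then have "norm_form i0 t s = 0" for s using prod[of t s] by simp
    moreover obtain s where "s \<notin> (\<lambda>T. (signed_sum T t)\<^sup>2) ` ?S"
      using ex_new_if_finite[OF infinite_UNIV_char_0, of "(\<lambda>T. (signed_sum T t)\<^sup>2) ` ?S"] by auto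
    ultimately show False by (auto simp: norm_form_def)
  qed
  define c where "c = eval_cpoly b 0"
  have "c \<noteq> 0" using nonzero by (simp add: c_def)
  \<comment> \<open>A zero-free polynomial is constant on each line through the origin.\<close>
  have const: "eval_cpoly b w = c" for w
  proof -
    obtain q where q: "\<And>l. eval_cpoly b (0 + l *s w) = poly q l"
      using polynomial_on_line[OF polynomial_eval_cpoly] by blast
    then have "constant (poly q)"
      using fundamental_theorem_of_algebra[of q] nonzero by metis
    then have "poly q 1 = poly q 0" by (simp add: constant_def)
    then show ?thesis using q[of 0] q[of 1] by (simp add: c_def)
  qed
  have "b * Poly_Mapping.single 0 (1 / c) = 1"
    using \<open>c \<noteq> 0\<close> by (intro cpoly_eqI) (simp add: eval_cpoly_mult eval_cpoly_single const)
  then show ?thesis by (metis dvd_triv_left)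
qed

lemma norm_form_irreducible:
  fixes p :: "'n::finite option cpoly"
  assumes p: "\<And>t s. eval_cpoly p (point (squares t) s) = norm_form i0 t s"
  shows "irreducible p"
proof (rule irreducibleI)
  have "norm_form i0 0 1 = 1"
    by (simp add: norm_form_def signed_sum_def signed_nth cong: if_cong)
  then show "p \<noteq> 0" using p[of 0 1] by auto
  show "\<not> p dvd 1"
  proof
    assume "p dvd 1"
    then obtain q where "1 = p * q" by (elim dvdE)
    then have "eval_cpoly p (point (squares 0) 0) * eval_cpoly q (point (squares 0) 0) = 1"
      by (metis eval_cpoly_mult eval_cpoly_one)
    moreover have "norm_form i0 0 0 = 0"
      unfolding norm_form_zero_iff by (intro exI[of _ 0]) simp
    ultimately show False using p[of 0 0] by simp
  qed
  fix a b assume ab: "p = a * b"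
  let ?\<phi> = "\<lambda>t. point (squares t) ((\<Sum>i\<in>UNIV. t $ i)\<^sup>2)"
  have prod: "eval_cpoly a (point (squares t) s) * eval_cpoly b (point (squares t) s) = norm_form i0 t s" for t s
    using p[of t s] ab by (simp add: eval_cpoly_mult)
  have "polynomial_on_C (\<lambda>t. ?\<phi> t $ v)" for v
    by (cases v) (auto intro!: polynomial_intros)
  then have pol: "polynomial_on_C (\<lambda>t. eval_cpoly c (?\<phi> t))" for c
    by (intro polynomial_compose[OF polynomial_eval_cpoly])
  have "eval_cpoly a (?\<phi> t) * eval_cpoly b (?\<phi> t) = 0" for t
    unfolding prod norm_form_zero_iff by blast
  then have "(\<forall>t. eval_cpoly a (?\<phi> t) = 0) \<or> (\<forall>t. eval_cpoly b (?\<phi> t) = 0)"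
    by (intro polynomial_product_zero pol)
  then show "a dvd 1 \<or> b dvd 1"
    using factor_of_norm_form_constant[of a b i0] factor_of_norm_form_constant[of b a i0] prod
    by (metis mult.commute)
qed

lemma norm_form_total_degree:
  fixes p :: "'n::finite option cpoly"
  assumes p: "\<And>t s. eval_cpoly p (point (squares t) s) = norm_form i0 t s"
  shows "total_degree p = 2 ^ (CARD('n) - 1)"
proof (rule total_degree_homogeneous)
  show "p \<noteq> 0" using norm_form_irreducible[OF p] by auto
  fix w :: "complex ^ 'n option"
  obtain t s where w: "w = point (squares t) s" by (rule point_squares_cases)
  have "4 *s w = point (squares (2 *s t)) (4 * s)"
    unfolding w scale_point by (simp add: vec_eq_iff point_def power_mult_distrib split: option.split)
  then have "eval_cpoly p (4 *s w) = (\<Prod>T\<in>Pow (- {i0}). 4 * (s - (signed_sum T t)\<^sup>2))"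
    by (simp add: p norm_form_def signed_sum_scale power_mult_distrib algebra_simps)
  also have "\<dots> = 4 ^ 2 ^ (CARD('n) - 1) * eval_cpoly p w"
    by (simp only: w p norm_form_def prod.distrib prod_constant card_sign_choices)
  finally show "eval_cpoly p (4 *s w) = 4 ^ 2 ^ (CARD('n) - 1) * eval_cpoly p w" .
qed

section \<open>The copositive cone\<close>

lemma square_of_sum_less:
  fixes f :: "'n::{finite,linorder} \<Rightarrow> real"
  shows "(\<Sum>i\<in>UNIV. f i)\<^sup>2 = (\<Sum>i\<in>UNIV. (f i)\<^sup>2) + 2 * (\<Sum>(i, j)\<in>{(i, j). i < j}. f i * f j)"
proof -
  let ?g = "\<lambda>(i, j). f i * f j"
  let ?D = "{(i, j). i = j} :: ('n \<times> 'n) set"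
  let ?L = "{(i, j). i < j} :: ('n \<times> 'n) set"
  let ?U = "{(i, j). j < i} :: ('n \<times> 'n) set"
  have "(\<Sum>i\<in>UNIV. f i)\<^sup>2 = sum ?g UNIV"
    by (simp add: power2_eq_square sum_product sum.cartesian_product)
  also have "(UNIV :: ('n \<times> 'n) set) = ?D \<union> (?L \<union> ?U)" by auto
  also have "sum ?g \<dots> = sum ?g ?D + sum ?g (?L \<union> ?U)"
    by (rule sum.union_disjoint) auto
  also have "sum ?g (?L \<union> ?U) = sum ?g ?L + sum ?g ?U"
    by (rule sum.union_disjoint) auto
  also have "sum ?g ?D = (\<Sum>i\<in>UNIV. (f i)\<^sup>2)"
    by (rule sum.reindex_bij_witness[of _ "\<lambda>i. (i, i)" fst]) (auto simp: power2_eq_square)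
  also have "sum ?g ?U = sum ?g ?L"
    by (rule sum.reindex_bij_witness[of _ "\<lambda>(i, j). (j, i)" "\<lambda>(i, j). (j, i)"]) auto
  finally show ?thesis by simp
qed

definition mass_cone :: "((real ^ 'n::finite) \<times> real) set" where
  "mass_cone = {(m, s). (\<forall>i. 0 \<le> m $ i) \<and> s \<le> (\<Sum>i\<in>UNIV. sqrt (m $ i))\<^sup>2}"

lemma in_mass_cone:
  "(m, s) \<in> mass_cone \<longleftrightarrow> (\<forall>i. 0 \<le> m $ i) \<and> s \<le> (\<Sum>i\<in>UNIV. sqrt (m $ i))\<^sup>2"
  by (simp add: mass_cone_def)

text \<open>In the open orthant this is the Cauchy-Schwarz inequality for the vectors with entries
  \<open>sqrt (m i * u i)\<close> and \<open>sqrt (1 / u i)\<close>; on its boundary the term with \<open>s\<close> vanishes.\<close>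

lemma banana_symanzik_nonneg:
  fixes m u :: "real ^ 'n::finite"
  assumes m: "\<And>i. 0 \<le> m $ i" and s: "s \<le> (\<Sum>i\<in>UNIV. sqrt (m $ i))\<^sup>2"
    and u: "\<And>i. 0 \<le> u $ i"
  shows "0 \<le> banana_symanzik (m, s) u"
proof (cases "\<forall>i. u $ i \<noteq> 0")
  case True
  have pos: "0 < u $ i" for i using True u[of i] by (simp add: less_le)
  have "(\<Sum>i\<in>UNIV. sqrt (m $ i)) = (\<Sum>i\<in>UNIV. sqrt (m $ i * u $ i) * sqrt (1 / u $ i))"
    using pos by (simp flip: real_sqrt_mult) (simp add: less_imp_neq[symmetric])
  then have "(\<Sum>i\<in>UNIV. sqrt (m $ i))\<^sup>2 \<le>
      (\<Sum>i\<in>UNIV. (sqrt (m $ i * u $ i))\<^sup>2) * (\<Sum>i\<in>UNIV. (sqrt (1 / u $ i))\<^sup>2)"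
    using Cauchy_Schwarz_ineq_sum by metis
  also have "\<dots> = (\<Sum>i\<in>UNIV. m $ i * u $ i) * (\<Sum>i\<in>UNIV. 1 / u $ i)"
    using m u by simp
  finally have "0 \<le> (\<Sum>i\<in>UNIV. m $ i * u $ i) * (\<Sum>i\<in>UNIV. 1 / u $ i) - s"
    using s by simp
  moreover have "0 \<le> (\<Prod>k\<in>UNIV. u $ k)" using u by (intro prod_nonneg) auto
  ultimately show ?thesis using True by (simp add: banana_symanzik_eq)
next
  case False
  then have P: "(\<Prod>k\<in>UNIV. u $ k) = 0" by (auto intro: prod_zero)
  show ?thesis
    unfolding banana_symanzik_def case_prod_conv P mult_zero_right diff_zero
    using m u by (intro mult_nonneg_nonneg sum_nonneg prod_nonneg) auto
qed

text \<open>On the face \<open>u k = 0\<close> only the linear form \<open>\<Sum>j. m j * u j\<close> matters, and near the \<open>i\<close>-th unit vector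
  its sign is that of \<open>m i\<close> unless \<open>m i = 0\<close>.  Such a \<open>k \<noteq> i\<close> exists because there are two edges.\<close>

lemma copositive_mass_nonneg:
  fixes m :: "real ^ 'n::finite"
  assumes card: "CARD('n) \<ge> 2"
    and cop: "\<And>u. (\<And>i. 0 \<le> u $ i) \<Longrightarrow> 0 \<le> banana_symanzik (m, s) u"
  shows "0 \<le> m $ i"
proof (rule ccontr)
  assume neg: "\<not> 0 \<le> m $ i"
  have "UNIV \<noteq> {i}"
  proof
    assume "UNIV = {i}"
    then have "CARD('n) = card {i}" by (rule arg_cong)
    then show False using card by simp
  qed
  then obtain k where k: "k \<noteq> i" by blast
  define R where "R = (\<Sum>j\<in>UNIV - {i, k}. m $ j)"
  \<comment> \<open>Small enough for the other masses to contribute at most \<open>- m i / 2\<close>.\<close>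
  define t where "t = - m $ i / (2 * (\<bar>R\<bar> + 1))"
  have t: "0 < t" using neg by (simp add: t_def field_simps)
  define u :: "real ^ 'n" where "u = (\<chi> j. if j = i then 1 else if j = k then 0 else t)"
  have "(\<Prod>l\<in>UNIV - {j}. u $ l) = 0" if "j \<noteq> k" for j
    using that k by (intro prod_zero) (auto simp: u_def intro!: bexI[of _ k])
  then have "(\<Sum>j\<in>UNIV - {k}. \<Prod>l\<in>UNIV - {j}. u $ l) = 0"
    by (intro sum.neutral ballI) blast
  then have "(\<Sum>j\<in>UNIV. \<Prod>l\<in>UNIV - {j}. u $ l) = (\<Prod>l\<in>UNIV - {k}. u $ l)"
    by (simp only: sum.remove[OF finite UNIV_I, of _ k] add_0_right)
  moreover have "(\<Prod>l\<in>UNIV. u $ l) = 0"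
    by (intro prod_zero) (auto simp: u_def intro!: exI[of _ k] k)
  ultimately have "banana_symanzik (m, s) u = (\<Sum>j\<in>UNIV. m $ j * u $ j) * (\<Prod>l\<in>UNIV - {k}. u $ l)"
    by (simp add: banana_symanzik_def)
  moreover have "0 \<le> banana_symanzik (m, s) u"
    by (rule cop) (use t in \<open>auto simp: u_def\<close>)
  moreover have "0 < (\<Prod>l\<in>UNIV - {k}. u $ l)"
    by (intro prod_pos) (use t in \<open>auto simp: u_def\<close>)
  ultimately have "0 \<le> (\<Sum>j\<in>UNIV. m $ j * u $ j)"
    by (simp add: zero_le_mult_iff)
  also have "\<dots> = m $ i + t * R"
  proof -
    have "(\<Sum>j\<in>UNIV. m $ j * u $ j) = m $ i + (m $ k * 0 + (\<Sum>j\<in>UNIV - {i} - {k}. m $ j * u $ j))"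
      using k by (simp add: sum.remove[of UNIV i] sum.remove[of "UNIV - {i}" k] u_def)
    also have "(\<Sum>j\<in>UNIV - {i} - {k}. m $ j * u $ j) = t * R"
      unfolding R_def sum_distrib_left by (intro sum.cong) (auto simp: u_def)
    finally show ?thesis by simp
  qed
  also have "t * R \<le> t * (\<bar>R\<bar> + 1)" using t by (intro mult_left_mono) auto
  also have "\<dots> = - m $ i / 2" by (simp add: t_def field_simps)
  finally show False using neg by simp
qed

text \<open>Equality in Cauchy-Schwarz would need \<open>u i = 1 / sqrt (m i)\<close>, which is not available for a vanishing
  mass; shifting the denominators by a small \<open>d > 0\<close> gives the bound up to an arbitrary error.\<close>

lemma copositive_momentum_bound:
  fixes m :: "real ^ 'n::finite"
  assumes m: "\<And>i. 0 \<le> m $ i"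
    and cop: "\<And>u. (\<And>i. 0 \<le> u $ i) \<Longrightarrow> 0 \<le> banana_symanzik (m, s) u"
  shows "s \<le> (\<Sum>i\<in>UNIV. sqrt (m $ i))\<^sup>2"
proof (rule field_le_epsilon)
  fix e :: real assume e: "0 < e"
  define S where "S = (\<Sum>i\<in>UNIV. sqrt (m $ i))"
  have S: "0 \<le> S" unfolding S_def using m by (intro sum_nonneg) auto
  \<comment> \<open>Chosen so that the total error \<open>S * n * d\<close> stays below \<open>e\<close>.\<close>
  define d where "d = e / (S * CARD('n) + 1)"
  have d: "0 < d" using e S by (simp add: d_def add_nonneg_pos)
  define u :: "real ^ 'n" where "u = (\<chi> i. 1 / (sqrt (m $ i) + d))"
  have den: "0 < sqrt (m $ i) + d" for i using d m[of i] by (simp add: add_nonneg_pos)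
  have u: "0 < u $ i" for i using den[of i] by (simp add: u_def)
  have "0 \<le> banana_symanzik (m, s) u" by (rule cop) (use u in \<open>auto intro: less_imp_le\<close>)
  then have "0 \<le> (\<Prod>k\<in>UNIV. u $ k) * ((\<Sum>i\<in>UNIV. m $ i * u $ i) * (\<Sum>j\<in>UNIV. 1 / u $ j) - s)"
    using u by (subst (asm) banana_symanzik_eq) (auto simp: less_imp_neq[symmetric])
  moreover have "0 < (\<Prod>k\<in>UNIV. u $ k)" using u by (intro prod_pos) auto
  ultimately have "s \<le> (\<Sum>i\<in>UNIV. m $ i * u $ i) * (\<Sum>j\<in>UNIV. 1 / u $ j)"
    by (simp add: zero_le_mult_iff)
  also have "(\<Sum>j\<in>UNIV. 1 / u $ j) = S + CARD('n) * d"
    by (simp add: u_def S_def sum.distrib)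
  also have "(\<Sum>i\<in>UNIV. m $ i * u $ i) * (S + CARD('n) * d) \<le> S * (S + CARD('n) * d)"
  proof (rule mult_right_mono)
    have "m $ i * u $ i \<le> sqrt (m $ i)" for i
    proof -
      have "m $ i = sqrt (m $ i) * sqrt (m $ i)" using m[of i] by simp
      also have "\<dots> \<le> sqrt (m $ i) * (sqrt (m $ i) + d)"
        using d m[of i] by (intro mult_left_mono) auto
      finally show ?thesis using den[of i] by (simp add: u_def pos_divide_le_eq)
    qed
    then show "(\<Sum>i\<in>UNIV. m $ i * u $ i) \<le> S" unfolding S_def by (intro sum_mono)
  qed (use S d in simp)
  also have "\<dots> = S\<^sup>2 + S * CARD('n) * d" by (simp add: power2_eq_square algebra_simps)
  also have "S * CARD('n) * d \<le> (S * CARD('n) + 1) * d" using d by simp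
  also have "\<dots> = e"
  proof -
    have "S * CARD('n) + 1 > 0" using S by (simp add: add_nonneg_pos)
    then show ?thesis by (simp add: d_def)
  qed
  finally show "s \<le> (\<Sum>i\<in>UNIV. sqrt (m $ i))\<^sup>2 + e" by (simp add: S_def)
qed

lemma copositive_cone_banana:
  assumes "CARD('n::finite) \<ge> 2"
  shows "copositive_cone (banana_symanzik :: (real ^ 'n) \<times> real \<Rightarrow> real ^ 'n \<Rightarrow> real) = mass_cone"
proof (intro equalityI subsetI)
  fix z :: "(real ^ 'n) \<times> real"
  assume "z \<in> copositive_cone banana_symanzik"
  then obtain m s where z: "z = (m, s)" and
    cop: "\<And>u. (\<And>i. 0 \<le> u $ i) \<Longrightarrow> 0 \<le> banana_symanzik (m, s) u"
    by (cases z) (auto simp: copositive_cone_def)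
  have "0 \<le> m $ i" for i using assms cop by (rule copositive_mass_nonneg)
  then show "z \<in> mass_cone"
    using copositive_momentum_bound[OF _ cop] by (auto simp: z mass_cone_def)
qed (auto simp: mass_cone_def copositive_cone_def intro!: banana_symanzik_nonneg)

section \<open>The boundary of the cone\<close>

lemma mass_cone_closed: "closed (mass_cone :: ((real ^ 'n::finite) \<times> real) set)"
proof -
  have eq: "mass_cone = {z :: (real ^ 'n) \<times> real. (\<forall>i. 0 \<le> fst z $ i) \<and> snd z \<le> (\<Sum>i\<in>UNIV. sqrt (fst z $ i))\<^sup>2}"
    by (auto simp: mass_cone_def)
  show ?thesis
    unfolding eq by (auto intro!: closed_Collect_conj closed_Collect_all closed_Collect_le continuous_intros)
qed

text \<open>Lowering a vanishing mass, or raising \<open>s\<close> at its bound, leaves the cone by an arbitrarily small step;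
  where all the inequalities are strict they stay so nearby.\<close>

lemma frontier_mass_cone:
  "frontier (mass_cone :: ((real ^ 'n::finite) \<times> real) set) =
    {(m, s). (m, s) \<in> mass_cone \<and> ((\<exists>i. m $ i = 0) \<or> s = (\<Sum>i\<in>UNIV. sqrt (m $ i))\<^sup>2)}"
proof (intro equalityI subsetI)
  fix z :: "(real ^ 'n) \<times> real"
  assume z: "z \<in> frontier mass_cone"
  obtain m s where ms: "z = (m, s)" by force
  have mem: "z \<in> mass_cone" using z mass_cone_closed frontier_subset_closed by blast
  let ?O = "(\<Inter>i. {z. 0 < fst z $ i}) \<inter> {z. snd z < (\<Sum>i\<in>UNIV. sqrt (fst z $ i))\<^sup>2}"
  have "open ?O"
    by (intro open_Int open_INT ballI finite open_Collect_less continuous_intros)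
  moreover have "?O \<subseteq> mass_cone" by (auto simp: mass_cone_def less_imp_le)
  ultimately have "?O \<subseteq> interior mass_cone" by (rule interior_maximal[rotated])
  then have "z \<notin> ?O" using z by (auto simp: frontier_def)
  then have "(\<exists>i. \<not> 0 < m $ i) \<or> \<not> s < (\<Sum>i\<in>UNIV. sqrt (m $ i))\<^sup>2"
    unfolding ms by simp
  moreover have "\<And>i. 0 \<le> m $ i" and "s \<le> (\<Sum>i\<in>UNIV. sqrt (m $ i))\<^sup>2"
    using mem by (simp_all add: ms in_mass_cone)
  ultimately have "(\<exists>i. m $ i = 0) \<or> s = (\<Sum>i\<in>UNIV. sqrt (m $ i))\<^sup>2"
    by (metis less_le)
  then show "z \<in> {(m, s). (m, s) \<in> mass_cone \<and> ((\<exists>i. m $ i = 0) \<or> s = (\<Sum>i\<in>UNIV. sqrt (m $ i))\<^sup>2)}"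
    using mem by (simp add: ms)
next
  fix z :: "(real ^ 'n) \<times> real"
  assume "z \<in> {(m, s). (m, s) \<in> mass_cone \<and> ((\<exists>i. m $ i = 0) \<or> s = (\<Sum>i\<in>UNIV. sqrt (m $ i))\<^sup>2)}"
  then obtain m s where z: "z = (m, s)" and mem: "(m, s) \<in> mass_cone"
    and bd: "(\<exists>i. m $ i = 0) \<or> s = (\<Sum>i\<in>UNIV. sqrt (m $ i))\<^sup>2" by auto
  show "z \<in> frontier mass_cone"
    unfolding frontier_straddle
  proof (intro allI impI conjI)
    fix e :: real assume e: "0 < e"
    show "\<exists>x\<in>mass_cone. dist z x < e" using mem z e by (intro bexI[of _ z]) auto
    from bd show "\<exists>x. x \<notin> mass_cone \<and> dist z x < e"
    proof
      assume "\<exists>i. m $ i = 0"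
      then obtain i where i: "m $ i = 0" ..
      define m' where "m' = m - (e / 2) *\<^sub>R axis i 1"
      have "m' $ i < 0" using e i by (simp add: m'_def)
      then have "(m', s) \<notin> mass_cone" by (auto simp: in_mass_cone not_le)
      moreover have "dist z (m', s) < e"
        using e by (simp add: z m'_def dist_Pair_Pair dist_norm)
      ultimately show ?thesis by blast
    next
      assume "s = (\<Sum>i\<in>UNIV. sqrt (m $ i))\<^sup>2"
      then have "(m, s + e / 2) \<notin> mass_cone" using e by (auto simp: in_mass_cone)
      moreover have "dist z (m, s + e / 2) < e"
        using e by (simp add: z dist_Pair_Pair dist_norm)
      ultimately show ?thesis by blast
    qed
  qed
qed

lemma in_frontier_mass_cone:
  "(m, s) \<in> frontier mass_cone \<longleftrightarrow> (\<forall>i. 0 \<le> m $ i) \<and> s \<le> (\<Sum>i\<in>UNIV. sqrt (m $ i))\<^sup>2 \<and>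
    ((\<exists>i. m $ i = 0) \<or> s = (\<Sum>i\<in>UNIV. sqrt (m $ i))\<^sup>2)"
  by (simp add: frontier_mass_cone in_mass_cone)

lemma complexify_point: "complexify (m, s) = point (\<chi> i. complex_of_real (m $ i)) (complex_of_real s)"
  by (simp add: complexify_def point_def vec_eq_iff split: option.split)

lemma infinite_of_real_image: "infinite A \<Longrightarrow> infinite (complex_of_real ` A)"
  by (simp add: finite_image_iff inj_on_def)

section \<open>The Zariski closure\<close>

text \<open>All points with \<open>m i = 0\<close>, the other masses positive and \<open>s < 0\<close> lie on the boundary, and they form an
  infinite grid in the hyperplane.\<close>

lemma polynomial_zero_on_hyperplane:
  fixes f :: "complex ^ 'n::finite option \<Rightarrow> complex"
  assumes "polynomial_on_C f" "\<And>z. z \<in> frontier mass_cone \<Longrightarrow> f (complexify z) = 0"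
    and w: "w $ Some i = 0"
  shows "f w = 0"
proof -
  define cut :: "complex ^ 'n option \<Rightarrow> complex ^ 'n option"
    where "cut w = (\<chi> v. if v = Some i then 0 else w $ v)" for w
  define S where "S v = complex_of_real ` (if v = None then {..<0} else {0<..})" for v :: "'n option"
  have "f (cut w) = 0"
  proof (rule polynomial_zero_of_grid[of "\<lambda>w. f (cut w)" S])
    have "polynomial_on_C (\<lambda>w. cut w $ v)" for v
      by (cases "v = Some i") (auto simp: cut_def intro!: polynomial_intros)
    then show "polynomial_on_C (\<lambda>w. f (cut w))"
      by (rule polynomial_compose[OF assms(1)])
    show "infinite (S v)" for v
      unfolding S_def by (rule infinite_of_real_image) (auto simp: infinite_Ioi infinite_Iio)
    fix w :: "complex ^ 'n option" assume S: "\<And>v. w $ v \<in> S v"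
    obtain s where s: "s < 0" "w $ None = complex_of_real s" using S[of None] by (auto simp: S_def)
    have "\<exists>r>0. w $ Some j = complex_of_real r" for j using S[of "Some j"] by (auto simp: S_def)
    then obtain r where r: "\<And>j. 0 < r j" "\<And>j. w $ Some j = complex_of_real (r j)" by metis
    define m where "m = (\<chi> j. if j = i then 0 else r j)"
    have "cut w = complexify (m, s)"
      using s r by (auto simp: complexify_point point_def cut_def m_def vec_eq_iff split: option.split)
    moreover have "s \<le> (\<Sum>j\<in>UNIV. sqrt (m $ j))\<^sup>2" using s by (meson less_imp_le order_trans zero_le_power2)
    then have "(m, s) \<in> frontier mass_cone"
      using r by (auto simp: in_frontier_mass_cone m_def less_imp_le)
    ultimately show "f (cut w) = 0" using assms(2) by simp
  qed
  moreover have "cut w = w" using w by (auto simp: cut_def vec_eq_iff)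
  ultimately show ?thesis by simp
qed

text \<open>For real \<open>t > 0\<close> the parametrization gives boundary points of the cone, since then \<open>t i\<close> is the
  square root of \<open>m i\<close>.\<close>

lemma polynomial_zero_on_norm_hypersurface:
  fixes f :: "complex ^ 'n::finite option \<Rightarrow> complex"
  assumes "polynomial_on_C f" "\<And>z. z \<in> frontier mass_cone \<Longrightarrow> f (complexify z) = 0"
  shows "f (point (squares t) ((\<Sum>i\<in>UNIV. t $ i)\<^sup>2)) = 0"
proof (rule polynomial_zero_of_grid[of "\<lambda>t. f (point (squares t) ((\<Sum>i\<in>UNIV. t $ i)\<^sup>2))" "\<lambda>_. complex_of_real ` {0<..}"])
  have "polynomial_on_C (\<lambda>t. point (squares t) ((\<Sum>i\<in>UNIV. t $ i)\<^sup>2) $ v)" for v :: "'n option"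
    by (cases v) (auto intro!: polynomial_intros)
  then show "polynomial_on_C (\<lambda>t. f (point (squares t) ((\<Sum>i\<in>UNIV. t $ i)\<^sup>2)))"
    by (rule polynomial_compose[OF assms(1)])
  show "infinite (complex_of_real ` {0<..})"
    by (rule infinite_of_real_image) (rule infinite_Ioi)
  fix t :: "complex ^ 'n" assume "\<And>v. t $ v \<in> complex_of_real ` {0<..}"
  then have "\<exists>r>0. t $ j = complex_of_real r" for j by (metis imageE greaterThan_iff)
  then obtain r where r: "\<And>j. 0 < r j" "\<And>j. t $ j = complex_of_real (r j)" by metis
  define m where "m = (\<chi> j. (r j)\<^sup>2)"
  have sqrt: "sqrt (m $ j) = r j" for j using r(1)[of j] by (simp add: m_def less_imp_le)
  have "point (squares t) ((\<Sum>i\<in>UNIV. t $ i)\<^sup>2) = complexify (m, (\<Sum>i\<in>UNIV. sqrt (m $ i))\<^sup>2)"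
    unfolding sqrt by (auto simp: complexify_point point_def m_def vec_eq_iff r(2) split: option.split)
  moreover have "(m, (\<Sum>i\<in>UNIV. sqrt (m $ i))\<^sup>2) \<in> frontier mass_cone"
    by (simp add: in_frontier_mass_cone m_def)
  ultimately show "f (point (squares t) ((\<Sum>i\<in>UNIV. t $ i)\<^sup>2)) = 0" using assms(2) by metis
qed

lemma algebraic_boundary_mass_cone:
  fixes p :: "'n::finite option cpoly"
  assumes p: "\<And>t s. eval_cpoly p (point (squares t) s) = norm_form i0 t s"
  shows "algebraic_boundary mass_cone = (\<Union>i. {w. w $ Some i = 0}) \<union> {w. eval_cpoly p w = 0}"
    (is "_ = ?R")
proof (rule equalityI)
  \<comment> \<open>The union of the hyperplanes and the hypersurface is the zero set of a single product.\<close>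
  have "polynomial_on_C (\<lambda>w. eval_cpoly p w * (\<Prod>i\<in>UNIV. w $ Some i))"
    by (intro polynomial_intros)
  then obtain q where q: "\<And>w. eval_cpoly p w * (\<Prod>i\<in>UNIV. w $ Some i) = eval_cpoly q w"
    by (auto simp: polynomial_on_C_def)
  have "?R = {w. \<forall>q'\<in>{q}. eval_cpoly q' w = 0}"
    by (auto simp flip: q)
  then have "zariski_closed ?R" unfolding zariski_closed_def by blast
  moreover have "complexify ` frontier mass_cone \<subseteq> ?R"
  proof (rule ccontr)
    assume "\<not> ?thesis"
    then obtain m s where fr: "(m, s) \<in> frontier mass_cone"
      and off: "complexify (m, s) \<notin> ?R" by auto
    have "eval_cpoly p (complexify (m, s)) = 0"
      if s: "s = (\<Sum>i\<in>UNIV. sqrt (m $ i))\<^sup>2"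
    proof -
      have nn: "0 \<le> m $ i" for i using fr by (simp add: in_frontier_mass_cone)
      define t where "t = (\<chi> i. complex_of_real (sqrt (m $ i)))"
      have "complexify (m, s) = point (squares t) ((\<Sum>i\<in>UNIV. t $ i)\<^sup>2)"
        using nn by (auto simp: complexify_point point_def t_def s vec_eq_iff
            split: option.split simp flip: of_real_power of_real_sum)
      then show ?thesis using p[of t] norm_form_zero_iff[of i0 t] by auto
    qed
    then obtain i where "m $ i = 0" using fr off by (auto simp: in_frontier_mass_cone)
    then have "complexify (m, s) $ Some i = 0" by (simp add: complexify_point)
    then show False using off by blast
  qed
  ultimately show "algebraic_boundary mass_cone \<subseteq> ?R"
    unfolding algebraic_boundary_def by (intro hull_minimal)
  have "?R \<subseteq> Z" if Z: "zariski_closed Z" "complexify ` frontier mass_cone \<subseteq> Z" for Z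
  proof
    fix w assume w: "w \<in> ?R"
    obtain P where P: "Z = {w. \<forall>f\<in>P. eval_cpoly f w = 0}"
      using Z(1) by (auto simp: zariski_closed_def)
    have "eval_cpoly f w = 0" if "f \<in> P" for f
    proof -
      have f: "eval_cpoly f (complexify z) = 0" if "z \<in> frontier mass_cone" for z
        using Z(2) \<open>f \<in> P\<close> that by (auto simp: P)
      show ?thesis
      proof (cases "\<exists>i. w $ Some i = 0")
        case True
        then show ?thesis
          using polynomial_zero_on_hyperplane[OF polynomial_eval_cpoly f] by blast
      next
        case False
        obtain t s where ts: "w = point (squares t) s" by (rule point_squares_cases)
        have "norm_form i0 t s = 0" using w False p[of t s] by (auto simp: ts)
        then obtain u where "squares u = squares t" "s = (\<Sum>i\<in>UNIV. u $ i)\<^sup>2"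
          unfolding norm_form_zero_iff by blast
        then show ?thesis
          using polynomial_zero_on_norm_hypersurface[OF polynomial_eval_cpoly f, of u] ts by simp
      qed
    qed
    then show "w \<in> Z" by (simp add: P)
  qed
  then show "?R \<subseteq> algebraic_boundary mass_cone"
    unfolding algebraic_boundary_def hull_def by blast
qed

theorem theorem4p1:
  assumes "CARD('n::{finite,linorder}) \<ge> 2"
  shows "copositive_cone (banana_symanzik :: (real ^ 'n::{finite,linorder}) \<times> real \<Rightarrow> real ^ 'n::{finite,linorder} \<Rightarrow> real) =
      {(m, s). (\<forall>i. 0 \<le> m $ i) \<and>
        (\<Sum>i\<in>UNIV. m $ i) + 2 * (\<Sum>(i, j)\<in>{(i, j). i < j}. sqrt (m $ i) * sqrt (m $ j)) \<ge> s}
    \<and> (\<exists>H. irreducible_hypersurface (2 ^ (CARD('n::{finite,linorder}) - 1)) H \<and>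
        algebraic_boundary (copositive_cone
            (banana_symanzik :: (real ^ 'n::{finite,linorder}) \<times> real \<Rightarrow> real ^ 'n::{finite,linorder} \<Rightarrow> real)) =
          (\<Union>i. {w. w $ Some i = 0}) \<union> H)"
proof
  have "(\<Sum>i\<in>UNIV. sqrt (m $ i))\<^sup>2 =
      (\<Sum>i\<in>UNIV. m $ i) + 2 * (\<Sum>(i, j)\<in>{(i, j). i < j}. sqrt (m $ i) * sqrt (m $ j))"
    if "\<forall>i. 0 \<le> m $ i" for m :: "real ^ 'n::{finite,linorder}"
    using that by (simp add: square_of_sum_less)
  then show "copositive_cone (banana_symanzik :: (real ^ 'n::{finite,linorder}) \<times> real \<Rightarrow> real ^ 'n::{finite,linorder} \<Rightarrow> real) =
      {(m, s). (\<forall>i. 0 \<le> m $ i) \<and>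
        (\<Sum>i\<in>UNIV. m $ i) + 2 * (\<Sum>(i, j)\<in>{(i, j). i < j}. sqrt (m $ i) * sqrt (m $ j)) \<ge> s}"
    unfolding copositive_cone_banana[OF assms] mass_cone_def by (auto 4 4)
  \<comment> \<open>The norm form depends on the normalizing edge only formally, so any edge will do.\<close>
  obtain p :: "'n option cpoly"
    where p: "\<And>t s. eval_cpoly p (point (squares t) s) = norm_form undefined t s"
    by (rule norm_form_polynomial[of "undefined :: 'n"]) blast
  let ?H = "{w. eval_cpoly p w = 0}"
  have "irreducible_hypersurface (2 ^ (CARD('n) - 1)) ?H"
    unfolding irreducible_hypersurface_def
    using norm_form_irreducible[OF p] norm_form_total_degree[OF p] by blast
  then show "\<exists>H. irreducible_hypersurface (2 ^ (CARD('n) - 1)) H \<and>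
      algebraic_boundary (copositive_cone
        (banana_symanzik :: (real ^ 'n::{finite,linorder}) \<times> real \<Rightarrow> real ^ 'n::{finite,linorder} \<Rightarrow> real)) =
      (\<Union>i. {w. w $ Some i = 0}) \<union> H"
    unfolding copositive_cone_banana[OF assms]
    using algebraic_boundary_mass_cone[OF p] by blast
qed

end
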